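(* Let $\nu>0$ and let $\mathcal{A}$ be the complex Lie algebra with basis $x_1,\dots,x_5$ and brackets (those not determined by the following by antisymmetry being zero) $$[x_1,x_2]=-x_4,\quad [x_1,x_4]=-x_4,\quad [x_2,x_4]=x_4,\quad [x_3,x_4]=-x_1+x_2,$$ $$[x_1,x_3]=-x_2+x_3+x_4-(1+\nu)x_5,\qquad [x_2,x_3]=x_1-x_3-x_4+(1+\nu)x_5.$$ Then $\mathcal{A}$ is a $5$-dimensional reductive Lie algebra whose center has dimension two and is given by $\mathcal{Z}_{\mathcal{A}}=\langle x_1+x_2-x_4,\ x_5\rangle$. Moreover $\mathcal{A}=[\mathcal{A},\mathcal{A}]\oplus\mathcal{Z}_{\mathcal{A}}$, with $[\mathcal{A},\mathcal{A}]$ isomorphic to $\mathfrak{sl}(2,\mathbb{C})$. In particular, $$\mathcal{C}_1=-4x_4\big(x_1-x_3-x_4+(1+\nu)x_5\big)+(x_4-x_1+x_2)^2,\qquad \mathcal{C}_2=x_1+x_2-x_4,\qquad \mathcal{C}_3=x_5$$ are Casimir elements of $\mathcal{A}$.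
   Context: A Lie algebra is called reductive if its radical equals its center. A Casimir element of $\mathcal{A}$ is an element of the center of the universal enveloping algebra of $\mathcal{A}$.
   Formalization: The printed C_1 is not central for any ν (its image in the 2×2 representation of sl(2) is diag(-3,1)); the formal C_1 has +4 in place of -4, and the product of x_4 with (x_1-x_3-x_4+(1+ν)x_5) is read as the symmetrized product (ab+ba)/2. *)

theory Defs
  imports "HOL-Analysis.Analysis" "HOL-Algebra.QuotRing" "HOL-Library.Poly_Mapping"
begin

section \<open>Lie algebras\<close>

text \<open>
  A Lie algebra over a field is given by a scalar multiplication \<open>smul\<close> on an ambient type, a
  carrier subspace \<open>L\<close>, and a bracket \<open>br\<close>, whose values matter on \<open>L\<close> only.
\<close>

locale lie_algebra = vector_space smul
  for smul :: "'k::field \<Rightarrow> 'a::ab_group_add \<Rightarrow> 'a" +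
  fixes L :: "'a set" and br :: "'a \<Rightarrow> 'a \<Rightarrow> 'a"
  assumes subspace_carrier: "subspace L"
    and br_closed: "\<lbrakk>x \<in> L; y \<in> L\<rbrakk> \<Longrightarrow> br x y \<in> L"
    and br_add_left: "\<lbrakk>x \<in> L; y \<in> L; z \<in> L\<rbrakk> \<Longrightarrow> br (x + y) z = br x z + br y z"
    and br_add_right: "\<lbrakk>x \<in> L; y \<in> L; z \<in> L\<rbrakk> \<Longrightarrow> br x (y + z) = br x y + br x z"
    and br_scale_left: "\<lbrakk>x \<in> L; y \<in> L\<rbrakk> \<Longrightarrow> br (smul c x) y = smul c (br x y)"
    and br_scale_right: "\<lbrakk>x \<in> L; y \<in> L\<rbrakk> \<Longrightarrow> br x (smul c y) = smul c (br x y)"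
    and br_alternating: "x \<in> L \<Longrightarrow> br x x = 0"
    and jacobi: "\<lbrakk>x \<in> L; y \<in> L; z \<in> L\<rbrakk>
                  \<Longrightarrow> br x (br y z) + br y (br z x) + br z (br x y) = 0"

definition lie_center :: "'a::ab_group_add set \<Rightarrow> ('a \<Rightarrow> 'a \<Rightarrow> 'a) \<Rightarrow> 'a set" where
  "lie_center L br = {z \<in> L. \<forall>x\<in>L. br z x = 0}"

definition lie_product ::
  "('k::field \<Rightarrow> 'a::ab_group_add \<Rightarrow> 'a) \<Rightarrow> ('a \<Rightarrow> 'a \<Rightarrow> 'a) \<Rightarrow> 'a set \<Rightarrow> 'a set \<Rightarrow> 'a set" where
  "lie_product smul br I J = module.span smul {br x y | x y. x \<in> I \<and> y \<in> J}"

definition lie_ideal ::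
  "('k::field \<Rightarrow> 'a::ab_group_add \<Rightarrow> 'a) \<Rightarrow> 'a set \<Rightarrow> ('a \<Rightarrow> 'a \<Rightarrow> 'a) \<Rightarrow> 'a set \<Rightarrow> bool" where
  "lie_ideal smul L br I \<longleftrightarrow>
     module.subspace smul I \<and> I \<subseteq> L \<and> (\<forall>x\<in>L. \<forall>y\<in>I. br x y \<in> I)"

definition lie_solvable ::
  "('k::field \<Rightarrow> 'a::ab_group_add \<Rightarrow> 'a) \<Rightarrow> ('a \<Rightarrow> 'a \<Rightarrow> 'a) \<Rightarrow> 'a set \<Rightarrow> bool" where
  "lie_solvable smul br I \<longleftrightarrow> (\<exists>n. ((\<lambda>J. lie_product smul br J J) ^^ n) I = {0})"

text \<open>
  The radical is the largest solvable ideal, which always exists in finite dimension; for an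
  algebra without a largest solvable ideal the value below is unspecified.
\<close>

definition lie_radical ::
  "('k::field \<Rightarrow> 'a::ab_group_add \<Rightarrow> 'a) \<Rightarrow> 'a set \<Rightarrow> ('a \<Rightarrow> 'a \<Rightarrow> 'a) \<Rightarrow> 'a set" where
  "lie_radical smul L br =
     (THE R. lie_ideal smul L br R \<and> lie_solvable smul br R \<and>
             (\<forall>I. lie_ideal smul L br I \<and> lie_solvable smul br I \<longrightarrow> I \<subseteq> R))"

definition lie_reductive ::
  "('k::field \<Rightarrow> 'a::ab_group_add \<Rightarrow> 'a) \<Rightarrow> 'a set \<Rightarrow> ('a \<Rightarrow> 'a \<Rightarrow> 'a) \<Rightarrow> bool" where
  "lie_reductive smul L br \<longleftrightarrow>
     lie_algebra smul L br \<and> lie_radical smul L br = lie_center L br"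

definition lie_direct_sum ::
  "('k::field \<Rightarrow> 'a::ab_group_add \<Rightarrow> 'a) \<Rightarrow> 'a set \<Rightarrow> ('a \<Rightarrow> 'a \<Rightarrow> 'a) \<Rightarrow> 'a set \<Rightarrow> 'a set \<Rightarrow> bool" where
  "lie_direct_sum smul L br I J \<longleftrightarrow>
     lie_ideal smul L br I \<and> lie_ideal smul L br J \<and>
     L = {x + y | x y. x \<in> I \<and> y \<in> J} \<and> I \<inter> J = {0}"

definition lie_isomorphic ::
  "('k::field \<Rightarrow> 'a::ab_group_add \<Rightarrow> 'a) \<Rightarrow> 'a set \<Rightarrow> ('a \<Rightarrow> 'a \<Rightarrow> 'a) \<Rightarrow>
   ('k \<Rightarrow> 'b::ab_group_add \<Rightarrow> 'b) \<Rightarrow> 'b set \<Rightarrow> ('b \<Rightarrow> 'b \<Rightarrow> 'b) \<Rightarrow> bool" where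
  "lie_isomorphic smul L br smul' L' br' \<longleftrightarrow>
     lie_algebra smul L br \<and> lie_algebra smul' L' br' \<and>
     (\<exists>f. bij_betw f L L' \<and>
          (\<forall>x\<in>L. \<forall>y\<in>L. f (x + y) = f x + f y) \<and>
          (\<forall>c. \<forall>x\<in>L. f (smul c x) = smul' c (f x)) \<and>
          (\<forall>x\<in>L. \<forall>y\<in>L. f (br x y) = br' (f x) (f y)))"

definition mat_scale :: "'k::field \<Rightarrow> 'k^'n^'n \<Rightarrow> 'k^'n^'n" where
  "mat_scale c M = (\<chi> i j. c * M $ i $ j)"

definition mat_commutator :: "'k::field^'n^'n \<Rightarrow> 'k^'n^'n \<Rightarrow> 'k^'n^'n" where
  "mat_commutator M N = M ** N - N ** M"

definition sl2_carrier :: "(complex^2^2) set" where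
  "sl2_carrier = {M. trace M = 0}"


section \<open>Universal enveloping algebras and Casimir elements\<close>

text \<open>
  Finitely supported functions on words form, under convolution, the free associative algebra on
  the letters, once the words are a monoid (written additively) under concatenation.
\<close>

instantiation list :: (type) monoid_add
begin

definition zero_list :: "'a list" where "zero_list = []"
definition plus_list :: "'a list \<Rightarrow> 'a list \<Rightarrow> 'a list" where "plus_list = append"

instance
  by standard (simp_all add: zero_list_def plus_list_def)

end

definition free_alg :: "'a set \<Rightarrow> ('a list \<Rightarrow>\<^sub>0 'k::field) ring" where
  "free_alg L =
     \<lparr>carrier = {p. \<forall>w\<in>Poly_Mapping.keys p. set w \<subseteq> L},
      mult = (*), one = 1, zero = 0, add = (+)\<rparr>"

definition gen :: "'a \<Rightarrow> 'a list \<Rightarrow>\<^sub>0 'k::field" where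
  "gen x = Poly_Mapping.single [x] 1"

definition const :: "'k \<Rightarrow> 'a list \<Rightarrow>\<^sub>0 'k::field" where
  "const c = Poly_Mapping.single [] c"

text \<open>
  The generators are all elements of \<open>L\<close>. The first family of relations cuts the free algebra down
  to the tensor algebra of \<open>L\<close>, the second one imposes \<open>x y - y x = [x, y]\<close>.
\<close>

definition uea_relations ::
  "('k::field \<Rightarrow> 'a::ab_group_add \<Rightarrow> 'a) \<Rightarrow> 'a set \<Rightarrow> ('a \<Rightarrow> 'a \<Rightarrow> 'a) \<Rightarrow> ('a list \<Rightarrow>\<^sub>0 'k) set" where
  "uea_relations smul L br =
     {gen (smul a x + smul b y) - (const a * gen x + const b * gen y) | a b x y.
        x \<in> L \<and> y \<in> L} \<union>
     {gen x * gen y - gen y * gen x - gen (br x y) | x y. x \<in> L \<and> y \<in> L}"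

definition uea_ideal ::
  "('k::field \<Rightarrow> 'a::ab_group_add \<Rightarrow> 'a) \<Rightarrow> 'a set \<Rightarrow> ('a \<Rightarrow> 'a \<Rightarrow> 'a) \<Rightarrow> ('a list \<Rightarrow>\<^sub>0 'k) set" where
  "uea_ideal smul L br = genideal (free_alg L) (uea_relations smul L br)"

definition uea ::
  "('k::field \<Rightarrow> 'a::ab_group_add \<Rightarrow> 'a) \<Rightarrow> 'a set \<Rightarrow> ('a \<Rightarrow> 'a \<Rightarrow> 'a) \<Rightarrow>
   ('a list \<Rightarrow>\<^sub>0 'k) set ring" where
  "uea smul L br = free_alg L Quot uea_ideal smul L br"

definition uea_class ::
  "('k::field \<Rightarrow> 'a::ab_group_add \<Rightarrow> 'a) \<Rightarrow> 'a set \<Rightarrow> ('a \<Rightarrow> 'a \<Rightarrow> 'a) \<Rightarrow>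
   ('a list \<Rightarrow>\<^sub>0 'k) \<Rightarrow> ('a list \<Rightarrow>\<^sub>0 'k) set" where
  "uea_class smul L br p = uea_ideal smul L br +>\<^bsub>free_alg L\<^esub> p"

definition casimir_elements ::
  "('k::field \<Rightarrow> 'a::ab_group_add \<Rightarrow> 'a) \<Rightarrow> 'a set \<Rightarrow> ('a \<Rightarrow> 'a \<Rightarrow> 'a) \<Rightarrow>
   ('a list \<Rightarrow>\<^sub>0 'k) set set" where
  "casimir_elements smul L br =
     {z \<in> carrier (uea smul L br). \<forall>u\<in>carrier (uea smul L br).
        z \<otimes>\<^bsub>uea smul L br\<^esub> u = u \<otimes>\<^bsub>uea smul L br\<^esub> z}"

definition sym_prod :: "('a list \<Rightarrow>\<^sub>0 'k::field) \<Rightarrow> ('a list \<Rightarrow>\<^sub>0 'k) \<Rightarrow> 'a list \<Rightarrow>\<^sub>0 'k" where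
  "sym_prod p q = const (1 / 2) * (p * q + q * p)"


section \<open>The five-dimensional algebra\<close>

definition X :: "5 \<Rightarrow> complex^5" where
  "X i = axis i 1"

text \<open>The brackets of basis vectors that are listed explicitly; all other entries are zero.\<close>

definition bracket_table :: "real \<Rightarrow> 5 \<Rightarrow> 5 \<Rightarrow> complex^5" where
  "bracket_table \<nu> i j =
     (if i = 1 \<and> j = 2 then - X 4
      else if i = 1 \<and> j = 4 then - X 4
      else if i = 2 \<and> j = 4 then X 4
      else if i = 3 \<and> j = 4 then - X 1 + X 2
      else if i = 1 \<and> j = 3 then - X 2 + X 3 + X 4 - complex_of_real (1 + \<nu>) *s X 5
      else if i = 2 \<and> j = 3 then X 1 - X 3 - X 4 + complex_of_real (1 + \<nu>) *s X 5
      else 0)"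

text \<open>
  The antisymmetric bilinear extension of the table: no pair is listed in both orders, so the
  antisymmetrised entry at \<open>(i, j)\<close> is the bracket of \<open>X i\<close> and \<open>X j\<close>.
\<close>

definition A_br :: "real \<Rightarrow> complex^5 \<Rightarrow> complex^5 \<Rightarrow> complex^5" where
  "A_br \<nu> u v =
     (\<Sum>i\<in>UNIV. \<Sum>j\<in>UNIV. (u $ i * v $ j) *s (bracket_table \<nu> i j - bracket_table \<nu> j i))"

definition A_center :: "real \<Rightarrow> (complex^5) set" where
  "A_center \<nu> = lie_center UNIV (A_br \<nu>)"

definition A_derived :: "real \<Rightarrow> (complex^5) set" where
  "A_derived \<nu> = lie_product (*s) (A_br \<nu>) UNIV UNIV"

text \<open>
  Representatives in the free algebra. The published expression for the quadratic element reads
  \<open>-4 x4 (x1 - x3 - x4 + (1+\<nu>) x5) + (x4 - x1 + x2)^2\<close>. With \<open>e = x4\<close>,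
  \<open>f = x1 - x3 - x4 + (1+\<nu>) x5\<close>, \<open>h = x4 - x1 + x2\<close> the table gives \<open>[e,f] = h\<close>, \<open>[h,e] = 2 e\<close>,
  \<open>[h,f] = -2 f\<close>, so \<open>h^2 - 4 e f\<close> is not central, whatever the order of the factors (nor invariant in
  the symmetric algebra). The sign is therefore corrected to \<open>+4\<close>, and the commutatively written
  monomial \<open>e f\<close> stands for the symmetrised product \<open>(e f + f e) / 2\<close>.
\<close>

definition C1 :: "real \<Rightarrow> (complex^5) list \<Rightarrow>\<^sub>0 complex" where
  "C1 \<nu> = 4 * sym_prod (gen (X 4)) (gen (X 1 - X 3 - X 4 + complex_of_real (1 + \<nu>) *s X 5))
          + (gen (X 4 - X 1 + X 2))\<^sup>2"

definition C2 :: "(complex^5) list \<Rightarrow>\<^sub>0 complex" where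
  "C2 = gen (X 1 + X 2 - X 4)"

definition C3 :: "(complex^5) list \<Rightarrow>\<^sub>0 complex" where
  "C3 = gen (X 5)"

end

theory Submission
  imports Defs
begin

text \<open>
  The algebra is a disguised direct sum of \<open>sl(2)\<close> and a two-dimensional centre. Put
  \<open>e = x\<^sub>4\<close>, \<open>f = x\<^sub>1 - x\<^sub>3 - x\<^sub>4 + (1 + \<nu>) x\<^sub>5\<close>, \<open>h = x\<^sub>4 - x\<^sub>1 + x\<^sub>2\<close>. The table gives \<open>[e, f] = h\<close>,
  \<open>[h, e] = 2 e\<close>, \<open>[h, f] = - 2 f\<close>, and \<open>x\<^sub>1 + x\<^sub>2 - x\<^sub>4\<close> and \<open>x\<^sub>5\<close> complete these vectors to a basis and
  commute with everything. Reading off the coordinates at \<open>h\<close>, \<open>e\<close>, \<open>f\<close> as a traceless matrix is thus a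
  linear projection onto \<open>sl(2)\<close> with a linear section, and the single identity \<open>A_br_eq\<close> says that
  the bracket is computed by projecting, taking the commutator, and lifting back.

  The structural claims hold with any simple Lie algebra in place of \<open>sl(2)\<close>, and they are proved
  in that generality in the locale \<open>split_extension\<close>: the Lie algebra laws are inherited from the simple
  algebra, the centre is the kernel of the projection, the derived algebra is the image of the section,
  and the two are complementary ideals. A noncentral ideal contains this image, which is perfect,
  so a solvable ideal is central and the radical is the centre.

  For the Casimir elements, \<open>casimirI\<close> reduces centrality in the enveloping algebra to commutation with
  a spanning set of the Lie algebra modulo the defining relations. Central vectors satisfy this at
  once, and \<open>sl2_casimir\<close> checks the quadratic element against \<open>e\<close>, \<open>f\<close>, \<open>h\<close> and the centre by identities
  in the free algebra.
\<close>

section \<open>Central elements of the enveloping algebra\<close>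

lemma mem_free_alg: "p \<in> carrier (free_alg L) \<longleftrightarrow> (\<forall>w\<in>Poly_Mapping.keys p. set w \<subseteq> L)"
  by (simp add: free_alg_def)

lemma free_alg_ops [simp]:
  "p \<otimes>\<^bsub>free_alg L\<^esub> q = p * q" "p \<oplus>\<^bsub>free_alg L\<^esub> q = p + q"
  "\<one>\<^bsub>free_alg L\<^esub> = 1" "\<zero>\<^bsub>free_alg L\<^esub> = 0"
  by (simp_all add: free_alg_def)

lemma single_in_free_alg: "set w \<subseteq> L \<Longrightarrow> Poly_Mapping.single w c \<in> carrier (free_alg L)"
  by (simp add: mem_free_alg)

lemma gen_in_free_alg: "x \<in> L \<Longrightarrow> gen x \<in> carrier (free_alg L)"
  by (simp add: gen_def single_in_free_alg)

lemma const_in_free_alg: "const c \<in> carrier (free_alg L)"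
  by (simp add: const_def single_in_free_alg)

lemma free_alg_closed:
  assumes "p \<in> carrier (free_alg L)" "q \<in> carrier (free_alg L)"
  shows "p + q \<in> carrier (free_alg L)" "p - q \<in> carrier (free_alg L)"
    "- p \<in> carrier (free_alg L)" "p * q \<in> carrier (free_alg L)"
proof -
  show "p + q \<in> carrier (free_alg L)" "p - q \<in> carrier (free_alg L)"
    using assms keys_add[of p q] keys_diff[of p q] by (auto simp: mem_free_alg)
  show "- p \<in> carrier (free_alg L)"
    using assms by (simp add: mem_free_alg)
  show "p * q \<in> carrier (free_alg L)"
    using assms keys_mult[of p q] by (fastforce simp: mem_free_alg plus_list_def)
qed

lemma ring_free_alg: "ring (free_alg L :: ('a list \<Rightarrow>\<^sub>0 'k::field) ring)"
proof (rule ringI)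
  show "abelian_group (free_alg L :: ('a list \<Rightarrow>\<^sub>0 'k) ring)"
  proof (rule abelian_groupI)
    fix p :: "'a list \<Rightarrow>\<^sub>0 'k"
    assume "p \<in> carrier (free_alg L)"
    then show "\<exists>q\<in>carrier (free_alg L). q \<oplus>\<^bsub>free_alg L\<^esub> p = \<zero>\<^bsub>free_alg L\<^esub>"
      by (intro bexI[of _ "- p"]) (auto intro: free_alg_closed)
  qed (auto intro: free_alg_closed simp: algebra_simps, simp add: mem_free_alg)
  show "Group.monoid (free_alg L :: ('a list \<Rightarrow>\<^sub>0 'k) ring)"
    by (rule monoidI)
      (auto intro: free_alg_closed simp: algebra_simps, simp add: mem_free_alg zero_list_def)
qed (simp_all add: algebra_simps)

lemma free_alg_minus:
  fixes p q :: "'a list \<Rightarrow>\<^sub>0 'k::field"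
  assumes "p \<in> carrier (free_alg L)" "q \<in> carrier (free_alg L)"
  shows "p \<ominus>\<^bsub>free_alg L\<^esub> q = p - q"
proof -
  interpret ring "free_alg L :: ('a list \<Rightarrow>\<^sub>0 'k) ring" by (rule ring_free_alg)
  have "\<ominus>\<^bsub>free_alg L\<^esub> q = - q"
    using assms by (intro minus_equality) (auto intro: free_alg_closed)
  then show ?thesis by (simp add: a_minus_def)
qed

lemma single_Cons: "Poly_Mapping.single (x # w) c = gen x * Poly_Mapping.single w c"
  by (simp add: gen_def mult_single plus_list_def)

lemma free_alg_induct [consumes 1, case_names zero single add]:
  assumes "p \<in> carrier (free_alg L)"
    and "P 0"
    and "\<And>w c. set w \<subseteq> L \<Longrightarrow> P (Poly_Mapping.single w c)"
    and "\<And>p q. P p \<Longrightarrow> P q \<Longrightarrow> P (p + q)"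
  shows "P p"
  using assms(1)
proof (induction p rule: update_induct)
  case const
  show ?case by (rule assms)
next
  case (update p w c)
  have eq: "Poly_Mapping.update w c p = p + Poly_Mapping.single w c"
    using update.hyps
    by (intro poly_mapping_eqI) (auto simp: lookup_add lookup_single lookup_update when_def in_keys_iff)
  have "Poly_Mapping.keys (Poly_Mapping.update w c p) = insert w (Poly_Mapping.keys p)"
    using update.hyps by (auto simp: keys_update)
  then show ?case
    using update by (auto simp: mem_free_alg eq intro!: assms(3,4))
qed

lemma const_commute:
  fixes p :: "'a list \<Rightarrow>\<^sub>0 'k::field"
  shows "const c * p = p * const c"
proof -
  have "p \<in> carrier (free_alg UNIV)" by (simp add: mem_free_alg)
  then show ?thesis
    by (induction p rule: free_alg_induct)
      (simp_all add: algebra_simps const_def mult_single plus_list_def)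
qed

lemma const_numeral: "const (numeral n) = numeral n"
  unfolding const_def by (simp flip: zero_list_def)

lemma const_mult: "const a * const b = const (a * b)"
  by (simp add: const_def mult_single plus_list_def)

lemma const_simps [simp]: "const 0 = 0" "const 1 = 1" "const (- a) = - const a"
  by (simp_all add: const_def single_uminus flip: zero_list_def)

lemma (in lie_algebra) uea_ideal_ideal: "ideal (uea_ideal smul L br) (free_alg L)"
  and uea_relations_in_uea_ideal: "uea_relations smul L br \<subseteq> uea_ideal smul L br"
proof -
  have "uea_relations smul L br \<subseteq> carrier (free_alg L)"
    using subspace_carrier br_closed unfolding uea_relations_def subspace_def
    by (auto intro!: free_alg_closed gen_in_free_alg const_in_free_alg)
  then show "ideal (uea_ideal smul L br) (free_alg L)"
    "uea_relations smul L br \<subseteq> uea_ideal smul L br"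
    unfolding uea_ideal_def using ring.genideal_ideal[OF ring_free_alg]
      ring.genideal_self[OF ring_free_alg] by blast+
qed

lemma (in lie_algebra) uea_ideal_closed:
  shows uea_ideal_zero: "0 \<in> uea_ideal smul L br"
    and uea_ideal_add: "\<lbrakk>p \<in> uea_ideal smul L br; q \<in> uea_ideal smul L br\<rbrakk>
      \<Longrightarrow> p + q \<in> uea_ideal smul L br"
    and uea_ideal_diff: "\<lbrakk>p \<in> uea_ideal smul L br; q \<in> uea_ideal smul L br\<rbrakk>
      \<Longrightarrow> p - q \<in> uea_ideal smul L br"
    and uea_ideal_mult_left: "\<lbrakk>r \<in> carrier (free_alg L); p \<in> uea_ideal smul L br\<rbrakk>
      \<Longrightarrow> r * p \<in> uea_ideal smul L br"
    and uea_ideal_mult_right: "\<lbrakk>r \<in> carrier (free_alg L); p \<in> uea_ideal smul L br\<rbrakk>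
      \<Longrightarrow> p * r \<in> uea_ideal smul L br"
proof -
  interpret J: ideal "uea_ideal smul L br" "free_alg L" by (rule uea_ideal_ideal)
  show "0 \<in> uea_ideal smul L br" using additive_subgroup.zero_closed[OF J.is_additive_subgroup] by simp
  show add: "p + q \<in> uea_ideal smul L br"
    if "p \<in> uea_ideal smul L br" "q \<in> uea_ideal smul L br" for p q
    using additive_subgroup.a_closed[OF J.is_additive_subgroup that] by simp
  show l: "r * p \<in> uea_ideal smul L br"
    if "r \<in> carrier (free_alg L)" "p \<in> uea_ideal smul L br" for r p
    using J.I_l_closed[OF that(2,1)] by simp
  show "p * r \<in> uea_ideal smul L br"
    if "r \<in> carrier (free_alg L)" "p \<in> uea_ideal smul L br" for r p
    using J.I_r_closed[OF that(2,1)] by simp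
  show "p - q \<in> uea_ideal smul L br"
    if "p \<in> uea_ideal smul L br" "q \<in> uea_ideal smul L br" for p q
    using add[OF that(1) l[OF const_in_free_alg[of "-1"] that(2)]] by simp
qed

lemma (in lie_algebra) gen_bracket:
  assumes "x \<in> L" "y \<in> L"
  shows "gen x * gen y - gen y * gen x - gen (br x y) \<in> uea_ideal smul L br"
  using uea_relations_in_uea_ideal assms unfolding uea_relations_def by blast

lemma (in lie_algebra) gen_linear:
  assumes "x \<in> L" "y \<in> L"
  shows "gen (smul a x + smul b y) - (const a * gen x + const b * gen y) \<in> uea_ideal smul L br"
  using uea_relations_in_uea_ideal assms unfolding uea_relations_def by blast

lemma (in lie_algebra) gen_zero: "gen 0 \<in> uea_ideal smul L br"
  using gen_linear[of 0 0 0 0] subspace_0[OF subspace_carrier] by simp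

lemma (in lie_algebra) gen_scale:
  assumes "x \<in> L"
  shows "gen (smul a x) - const a * gen x \<in> uea_ideal smul L br"
  using gen_linear[OF assms assms, of a 0] by simp

text \<open>
The commutator \<open>z x - x z\<close> of a fixed \<open>z\<close> is linear in the letter \<open>x\<close> modulo the relations, because
constants commute with everything. Commutation therefore has to be tested only on a spanning set.
\<close>

lemma (in lie_algebra) subspace_uea_centralizer:
  assumes z: "z \<in> carrier (free_alg L)"
  shows "subspace {x \<in> L. z * gen x - gen x * z \<in> uea_ideal smul L br}" (is "subspace ?C")
proof -
  have lin: "smul a x + smul b y \<in> ?C" if "x \<in> ?C" "y \<in> ?C" for a b x y
  proof -
    let ?d = "gen (smul a x + smul b y) - (const a * gen x + const b * gen y)"
    have L: "smul a x + smul b y \<in> L"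
      using that subspace_carrier by (auto intro: subspace_add subspace_scale)
    have d: "?d \<in> uea_ideal smul L br" using gen_linear that by blast
    have "z * gen (smul a x + smul b y) - gen (smul a x + smul b y) * z =
        (z * ?d - ?d * z) + (const a * (z * gen x - gen x * z) + const b * (z * gen y - gen y * z))"
      by (simp add: algebra_simps flip: mult.assoc)
         (simp add: const_commute[of _ z])
    also have "\<dots> \<in> uea_ideal smul L br"
      using that z d by (intro uea_ideal_add uea_ideal_diff)
        (auto intro: uea_ideal_mult_left uea_ideal_mult_right const_in_free_alg)
    finally show ?thesis using L by simp
  qed
  have "0 \<in> ?C"
    using gen_zero z subspace_0[OF subspace_carrier]
    by (auto intro: uea_ideal_diff uea_ideal_mult_left uea_ideal_mult_right)
  then show ?thesis
    unfolding subspace_def using lin[of _ _ 1 1] lin[of _ 0 _ 0] by auto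
qed

text \<open>
Commuting with the letters suffices for being central: a word is a product of letters, so
\<open>z x w - x w z = (z x - x z) w + x (z w - w z)\<close> carries commutation from letters to words, and by
linearity to all of the free algebra, whose classes exhaust the enveloping algebra.
\<close>

lemma (in lie_algebra) casimirI:
  assumes z: "z \<in> carrier (free_alg L)" and S: "span S = L"
    and comm: "\<And>x. x \<in> S \<Longrightarrow> z * gen x - gen x * z \<in> uea_ideal smul L br"
  shows "uea_class smul L br z \<in> casimir_elements smul L br"
proof -
  let ?J = "uea_ideal smul L br"
  interpret J: ideal ?J "free_alg L" by (rule uea_ideal_ideal)
  have "S \<subseteq> L" using S span_superset by blast
  then have "L \<subseteq> {x \<in> L. z * gen x - gen x * z \<in> ?J}"
    using comm span_minimal[OF _ subspace_uea_centralizer[OF z], of S] S by blast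
  then have gen: "z * gen x - gen x * z \<in> ?J" if "x \<in> L" for x
    using that by blast
  have single: "z * Poly_Mapping.single w c - Poly_Mapping.single w c * z \<in> ?J"
    if "set w \<subseteq> L" for w c
    using that
  proof (induction w)
    case Nil
    show ?case
      using const_commute[of c z] uea_ideal_zero by (simp add: const_def)
  next
    case (Cons x w)
    let ?q = "Poly_Mapping.single w c"
    have "z * (gen x * ?q) - gen x * ?q * z = (z * gen x - gen x * z) * ?q + gen x * (z * ?q - ?q * z)"
      by (simp add: algebra_simps)
    also have "\<dots> \<in> ?J"
      using Cons gen
      by (intro uea_ideal_add uea_ideal_mult_left uea_ideal_mult_right)
        (auto intro: gen_in_free_alg single_in_free_alg)
    finally show ?case unfolding single_Cons .
  qed
  have poly: "z * p - p * z \<in> ?J" if "p \<in> carrier (free_alg L)" for p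
    using that
  proof (induction p rule: free_alg_induct)
    case (add p q)
    have "z * (p + q) - (p + q) * z = (z * p - p * z) + (z * q - q * z)"
      by (simp add: algebra_simps)
    then show ?case using uea_ideal_add[OF add] by simp
  qed (simp_all add: single uea_ideal_zero)
  have carr: "carrier (uea smul L br) = uea_class smul L br ` carrier (free_alg L)"
    unfolding uea_def FactRing_def uea_class_def by (auto simp: A_RCOSETS_def')
  have mult: "uea_class smul L br p \<otimes>\<^bsub>uea smul L br\<^esub> uea_class smul L br q = uea_class smul L br (p * q)"
    if "p \<in> carrier (free_alg L)" "q \<in> carrier (free_alg L)" for p q
    using J.rcoset_mult_add[OF that] unfolding uea_def FactRing_def uea_class_def by simp
  have "uea_class smul L br (z * p) = uea_class smul L br (p * z)"
    if p: "p \<in> carrier (free_alg L)" for p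
    using poly[OF p] J.quotient_eq_iff_same_a_r_cos[OF uea_ideal_ideal, of "z * p" "p * z"] p z
    unfolding uea_class_def by (simp add: free_alg_minus free_alg_closed)
  then show ?thesis
    unfolding casimir_elements_def carr using z by (auto simp: mult)
qed

lemma (in lie_algebra) gen_central:
  assumes "x \<in> lie_center L br"
  shows "uea_class smul L br (gen x) \<in> casimir_elements smul L br"
proof (rule casimirI)
  have x: "x \<in> L" "\<And>y. y \<in> L \<Longrightarrow> br x y = 0" using assms by (auto simp: lie_center_def)
  show "gen x \<in> carrier (free_alg L)" by (rule gen_in_free_alg) fact
  show "span L = L" using subspace_carrier by (rule span_eq_iff[THEN iffD2])
  fix y assume "y \<in> L"
  then show "gen x * gen y - gen y * gen x \<in> uea_ideal smul L br"
    using uea_ideal_add[OF gen_bracket[of x y] gen_zero] x by simp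
qed

text \<open>
Expanding the commutators of \<open>z = 2 (e f + f e) + h\<^sup>2\<close> with \<open>e\<close>, \<open>f\<close>, \<open>h\<close> by the Leibniz rule and
inserting the relations, everything cancels; for instance
\<open>[z, e] = - 2 (e h + h e) + 2 (h e + e h) = 0\<close>. In the proof \<open>r\<close>, \<open>s\<close>, \<open>t\<close> are the defects of the
three relations, and the cancellation is an identity of the free algebra that exhibits each
commutator as a combination of terms \<open>p q + q p\<close> with \<open>q\<close> a defect. The centre supplies the remaining
generators, with which even \<open>e\<close>, \<open>f\<close>, \<open>h\<close> separately commute.
\<close>

lemma (in lie_algebra) sl2_casimir:
  assumes two: "(2::'k) \<noteq> 0" and L: "e \<in> L" "f \<in> L" "h \<in> L"
    and ef: "br e f = h" and he: "br h e = smul 2 e" and hf: "br h f = smul (-2) f"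
    and span: "span ({e, f, h} \<union> lie_center L br) = L"
  shows "uea_class smul L br (4 * sym_prod (gen e) (gen f) + (gen h)\<^sup>2) \<in> casimir_elements smul L br"
    (is "uea_class _ _ _ ?z \<in> _")
proof -
  let ?J = "uea_ideal smul L br"
  let ?E = "gen e :: 'a list \<Rightarrow>\<^sub>0 'k" and ?F = "gen f :: 'a list \<Rightarrow>\<^sub>0 'k"
    and ?H = "gen h :: 'a list \<Rightarrow>\<^sub>0 'k"
  define r where "r = ?E * ?F - ?F * ?E - ?H"
  define s where "s = ?H * ?E - ?E * ?H - 2 * ?E"
  define t where "t = ?H * ?F - ?F * ?H + 2 * ?F"
  note gens = gen_in_free_alg[OF L(1)] gen_in_free_alg[OF L(2)] gen_in_free_alg[OF L(3)]
  have r: "r \<in> ?J" unfolding r_def using gen_bracket[OF L(1,2)] ef by simp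
  have s: "s \<in> ?J"
    unfolding s_def using uea_ideal_add[OF gen_bracket[OF L(3,1)] gen_scale[OF L(1), of 2]] he
    by (simp add: const_numeral)
  have t: "t \<in> ?J"
    unfolding t_def using uea_ideal_add[OF gen_bracket[OF L(3,2)] gen_scale[OF L(2), of "-2"]] hf
    by (simp add: const_numeral)
  have c: "4 * const (1 / 2) = (2 :: 'a list \<Rightarrow>\<^sub>0 'k)"
  proof -
    have half: "4 * (1 / 2) = (2 :: 'k)" using two by (simp add: divide_eq_eq)
    have "4 * const (1 / 2) = const 4 * (const (1 / 2) :: 'a list \<Rightarrow>\<^sub>0 'k)"
      by (simp add: const_numeral)
    also have "\<dots> = const 2" by (simp only: const_mult half)
    finally show ?thesis by (simp add: const_numeral)
  qed
  have z: "?z = 2 * (?E * ?F + ?F * ?E) + ?H * ?H"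
    unfolding sym_prod_def power2_eq_square by (simp add: c flip: mult.assoc)
  have zE: "?z * ?E - ?E * ?z = (?H * s + s * ?H) - ((?E * r + r * ?E) + (?E * r + r * ?E))"
    unfolding z r_def s_def by (simp add: algebra_simps mult_2 mult_2_right)
  have zF: "?z * ?F - ?F * ?z = (?H * t + t * ?H) + ((?F * r + r * ?F) + (?F * r + r * ?F))"
    unfolding z r_def t_def by (simp add: algebra_simps mult_2 mult_2_right)
  have zH: "?z * ?H - ?H * ?z = 0 - (((?F * s + s * ?F) + (?E * t + t * ?E))
      + ((?F * s + s * ?F) + (?E * t + t * ?E)))"
    unfolding z s_def t_def by (simp add: algebra_simps mult_2 mult_2_right)
  have sym: "p * q + q * p \<in> ?J" if "p \<in> carrier (free_alg L)" "q \<in> ?J" for p q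
    by (intro uea_ideal_add uea_ideal_mult_left[OF that] uea_ideal_mult_right[OF that])
  note J = sym uea_ideal_add uea_ideal_diff uea_ideal_zero
  have comm: "?z * gen x - gen x * ?z \<in> ?J" if "x \<in> {e, f, h}" for x
    using that
  proof (elim insertE emptyE)
    show ?thesis if "x = e" unfolding that zE by (intro J r s gens)
    show ?thesis if "x = f" unfolding that zF by (intro J r t gens)
    show ?thesis if "x = h" unfolding that zH by (intro J s t gens)
  qed
  have central: "?z * gen x - gen x * ?z \<in> ?J" if x: "x \<in> lie_center L br" for x
  proof -
    have xy: "gen y * gen x - gen x * gen y \<in> ?J" if "y \<in> L" for y
      using uea_ideal_diff[OF uea_ideal_zero uea_ideal_add[OF gen_bracket[of x y] gen_zero]] x that
      by (simp add: lie_center_def)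
    define a where "a = ?E * gen x - gen x * ?E"
    define b where "b = ?F * gen x - gen x * ?F"
    define d where "d = ?H * gen x - gen x * ?H"
    have "?z * gen x - gen x * ?z = (?H * d + d * ?H) + (((?E * b + b * ?E) + (?F * a + a * ?F))
        + ((?E * b + b * ?E) + (?F * a + a * ?F)))"
      unfolding z a_def b_def d_def by (simp add: algebra_simps mult_2 mult_2_right)
    moreover have "a \<in> ?J" "b \<in> ?J" "d \<in> ?J" unfolding a_def b_def d_def by (intro xy L)+
    ultimately show ?thesis
      by (simp only:) (intro J gens)
  qed
  have "?z \<in> carrier (free_alg L)"
    unfolding z mult_2 by (intro free_alg_closed gens)
  then show ?thesis
    by (rule casimirI[OF _ span]) (use comm central in blast)
qed

section \<open>Extensions of simple Lie algebras by their centre\<close>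

lemma (in lie_algebra) br_zero: "x \<in> L \<Longrightarrow> br x 0 = 0" "x \<in> L \<Longrightarrow> br 0 x = 0"
  using br_scale_right[of x x 0] br_scale_left[of x x 0] by simp_all

lemma (in lie_algebra) br_antisym:
  assumes "x \<in> L" "y \<in> L"
  shows "br y x = - br x y"
proof -
  have xy: "x + y \<in> L" using assms subspace_add[OF subspace_carrier] by blast
  have "br (x + y) (x + y) = br x y + br y x"
    using assms xy br_alternating[of x] br_alternating[of y] by (simp add: br_add_left br_add_right)
  then have "br x y + br y x = 0" using br_alternating[OF xy] by simp
  then show ?thesis by (simp add: eq_neg_iff_add_eq_0 add.commute)
qed

lemma (in lie_algebra) lie_subalgebra:
  assumes "subspace K" "K \<subseteq> L" "\<And>x y. x \<in> K \<Longrightarrow> y \<in> K \<Longrightarrow> br x y \<in> K"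
  shows "lie_algebra smul K br"
  using assms br_add_left br_add_right br_scale_left br_scale_right br_alternating jacobi
  by unfold_locales (auto simp: subset_iff)

lemma (in lie_algebra) lie_ideal_center: "lie_ideal smul L br (lie_center L br)"
proof -
  have "subspace (lie_center L br)"
    using subspace_carrier unfolding subspace_def lie_center_def
    by (auto simp: br_zero br_add_left br_scale_left)
  moreover have "br x y = 0" if "x \<in> L" "y \<in> lie_center L br" for x y
    using that br_antisym[of y x] by (auto simp: lie_center_def)
  ultimately show ?thesis
    unfolding lie_ideal_def by (auto simp: subspace_0) (auto simp: lie_center_def)
qed

lemma (in lie_algebra) lie_solvable_center: "lie_solvable smul br (lie_center L br)"
proof -
  have "{br x y |x y. x \<in> lie_center L br \<and> y \<in> lie_center L br} \<subseteq> {0}"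
    by (auto simp: lie_center_def)
  then have "lie_product smul br (lie_center L br) (lie_center L br) \<subseteq> {0}"
    unfolding lie_product_def by (intro span_minimal) auto
  moreover have "0 \<in> lie_product smul br (lie_center L br) (lie_center L br)"
    unfolding lie_product_def by (rule span_zero)
  ultimately show ?thesis
    unfolding lie_solvable_def by (intro exI[of _ 1]) auto
qed

text \<open>
The centre is itself a solvable ideal. If it contains all the others, it is the largest one, which
is the definition of the radical.
\<close>

lemma (in lie_algebra) lie_reductiveI:
  assumes "\<And>I. lie_ideal smul L br I \<Longrightarrow> lie_solvable smul br I \<Longrightarrow> I \<subseteq> lie_center L br"
  shows "lie_reductive smul L br"
proof -
  have "lie_radical smul L br = lie_center L br"
    unfolding lie_radical_def
    by (rule the_equality) (use assms lie_ideal_center lie_solvable_center in \<open>blast+\<close>)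
  then show ?thesis
    unfolding lie_reductive_def using lie_algebra_axioms by blast
qed

lemma (in lie_algebra) lie_product_subset:
  assumes "subspace K" "\<And>x y. x \<in> I \<Longrightarrow> y \<in> J \<Longrightarrow> br x y \<in> K"
  shows "lie_product smul br I J \<subseteq> K"
  unfolding lie_product_def by (rule span_minimal) (use assms in auto)

lemma (in lie_algebra) bracket_in_lie_product:
  "x \<in> I \<Longrightarrow> y \<in> J \<Longrightarrow> br x y \<in> lie_product smul br I J"
  unfolding lie_product_def by (rule span_base) blast

lemma (in lie_algebra) lie_product_mono:
  assumes "I \<subseteq> I'" "J \<subseteq> J'"
  shows "lie_product smul br I J \<subseteq> lie_product smul br I' J'"
  unfolding lie_product_def by (rule span_mono) (use assms in blast)

lemma (in lie_algebra) lie_ideal_derived: "lie_ideal smul L br (lie_product smul br L L)"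
proof -
  have "lie_product smul br L L \<subseteq> L"
    by (rule lie_product_subset[OF subspace_carrier br_closed])
  moreover have "subspace (lie_product smul br L L)"
    unfolding lie_product_def by (rule subspace_span)
  ultimately show ?thesis
    unfolding lie_ideal_def using bracket_in_lie_product by blast
qed

text \<open>
A perfect \<open>D\<close> contained in \<open>I\<close> is contained in every term of the derived series of \<open>I\<close>, which
therefore never reaches zero.
\<close>

lemma (in lie_algebra) perfect_not_solvable:
  assumes "lie_product smul br D D = D" "D \<noteq> {0}" "D \<subseteq> I" and "0 \<in> D"
  shows "\<not> lie_solvable smul br I"
proof -
  have "D \<subseteq> ((\<lambda>J. lie_product smul br J J) ^^ n) I" for n
  proof (induction n)
    case (Suc n)
    then show ?case using lie_product_mono[OF Suc Suc] assms(1) by simp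
  qed (simp add: assms)
  then show ?thesis
    unfolding lie_solvable_def using assms(2,4) by blast
qed

text \<open>
The centre and the derived algebra are ideals, so simplicity decides both of them at once:
the centre is zero and the algebra is perfect.
\<close>

locale simple_lie_algebra = lie_algebra +
  assumes nonabelian: "\<exists>x\<in>L. \<exists>y\<in>L. br x y \<noteq> 0"
    and simple: "lie_ideal smul L br I \<Longrightarrow> I = {0} \<or> I = L"
begin

lemma center_trivial: "lie_center L br = {0}"
  using simple[OF lie_ideal_center] nonabelian by (auto simp: lie_center_def)

lemma perfect: "lie_product smul br L L = L"
  using simple[OF lie_ideal_derived] nonabelian bracket_in_lie_product[of _ L _ L] by blast

end

text \<open>
A Lie algebra that is the direct sum of its centre and a copy of a simple Lie algebra \<open>G\<close>, described
by the projection onto \<open>G\<close> and a linear section \<open>lift\<close>. The last assumption says that the bracket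
of \<open>u\<close> and \<open>v\<close> depends on their projections only and lies in the copy \<open>lift ` G\<close>; bilinearity and
the Jacobi identity are then inherited from \<open>G\<close>.
\<close>

locale split_extension =
  A: vector_space smulA + G: simple_lie_algebra smulG G brG
  for smulA :: "'k::field \<Rightarrow> 'a::ab_group_add \<Rightarrow> 'a"
    and smulG :: "'k \<Rightarrow> 'b::ab_group_add \<Rightarrow> 'b" and G brG +
  fixes proj :: "'a \<Rightarrow> 'b" and lift :: "'b \<Rightarrow> 'a" and br :: "'a \<Rightarrow> 'a \<Rightarrow> 'a"
  assumes proj_closed: "proj u \<in> G"
    and proj_add: "proj (u + v) = proj u + proj v"
    and proj_scale: "proj (smulA c u) = smulG c (proj u)"
    and lift_add: "\<lbrakk>m \<in> G; n \<in> G\<rbrakk> \<Longrightarrow> lift (m + n) = lift m + lift n"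
    and lift_scale: "m \<in> G \<Longrightarrow> lift (smulG c m) = smulA c (lift m)"
    and proj_lift: "m \<in> G \<Longrightarrow> proj (lift m) = m"
    and br_eq: "br u v = lift (brG (proj u) (proj v))"
begin

lemma lift_zero: "lift 0 = 0"
  using lift_scale[of 0 0] G.subspace_0[OF G.subspace_carrier] by simp

lemma proj_zero: "proj 0 = 0"
  using proj_scale[of 0 0] by simp

lemma proj_br: "proj (br u v) = brG (proj u) (proj v)"
  by (simp add: br_eq proj_lift G.br_closed proj_closed)

lemma lie_algebra_total: "lie_algebra smulA UNIV br"
proof unfold_locales
  note cl = G.br_closed proj_closed lift_add[symmetric] lift_scale[symmetric]
    G.subspace_add[OF G.subspace_carrier]
  show "A.subspace UNIV" by (rule A.subspace_UNIV)
  show "br u u = 0" for u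
    by (simp add: br_eq G.br_alternating proj_closed lift_zero)
  show "br u (br v w) + br v (br w u) + br w (br u v) = 0" for u v w
    unfolding br_eq[of _ "br _ _"] proj_br
    by (simp add: cl G.jacobi lift_zero)
qed (simp_all add: br_eq proj_add proj_scale G.br_add_left G.br_add_right G.br_scale_left
      G.br_scale_right G.br_closed proj_closed lift_add lift_scale)

sublocale A: lie_algebra smulA UNIV br
  by (rule lie_algebra_total)

lemma center_eq: "lie_center UNIV br = {u. proj u = 0}"
proof -
  have "proj u = 0" if "\<forall>v. br u v = 0" for u
  proof -
    have "brG (proj u) m = 0" if "m \<in> G" for m
      using arg_cong[of _ _ proj, OF spec[OF \<open>\<forall>v. br u v = 0\<close>, of "lift m"]] that
      by (simp add: proj_br proj_lift proj_zero)
    then show ?thesis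
      using G.center_trivial proj_closed[of u] by (auto simp: lie_center_def)
  qed
  moreover have "br u v = 0" if "proj u = 0" for u v
    using that G.br_zero proj_closed by (simp add: br_eq lift_zero)
  ultimately show ?thesis by (auto simp: lie_center_def)
qed

lemma subspace_lift: "A.subspace (lift ` K)" if "G.subspace K" "K \<subseteq> G"
proof -
  have "0 \<in> lift ` K" using that lift_zero G.subspace_0 by force
  moreover have "lift m + lift n \<in> lift ` K" if "m \<in> K" "n \<in> K" for m n
    using that \<open>K \<subseteq> G\<close> G.subspace_add[OF \<open>G.subspace K\<close>] by (subst lift_add[symmetric]) auto
  moreover have "smulA c (lift m) \<in> lift ` K" if "m \<in> K" for c m
    using that \<open>K \<subseteq> G\<close> G.subspace_scale[OF \<open>G.subspace K\<close>] by (subst lift_scale[symmetric]) auto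
  ultimately show ?thesis unfolding A.subspace_def by blast
qed

text \<open>
Brackets lie in the copy of \<open>G\<close> by the shape of the bracket. Conversely, the elements of \<open>G\<close> whose lift
is in the derived algebra form a subspace that contains all brackets of \<open>G\<close>, hence all of \<open>G\<close>,
as \<open>G\<close> is perfect.
\<close>

lemma derived_eq: "lie_product smulA br UNIV UNIV = lift ` G"
proof
  show "lie_product smulA br UNIV UNIV \<subseteq> lift ` G"
    by (rule A.lie_product_subset[OF subspace_lift[OF G.subspace_carrier order_refl]])
      (simp add: br_eq G.br_closed proj_closed)
  let ?K = "{m \<in> G. lift m \<in> lie_product smulA br UNIV UNIV}"
  have sub: "A.subspace (lie_product smulA br UNIV UNIV)"
    unfolding lie_product_def by (rule A.subspace_span)
  have "G.subspace ?K"
    using G.subspace_carrier A.subspace_0[OF sub] A.subspace_add[OF sub] A.subspace_scale[OF sub]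
    by (auto simp: G.subspace_def lift_add lift_scale lift_zero)
  moreover have "brG m n \<in> ?K" if "m \<in> G" "n \<in> G" for m n
    using that A.bracket_in_lie_product[of "lift m" UNIV "lift n" UNIV]
    by (simp add: br_eq proj_lift G.br_closed)
  ultimately have "lie_product smulG brG G G \<subseteq> ?K"
    by (rule G.lie_product_subset)
  then show "lift ` G \<subseteq> lie_product smulA br UNIV UNIV"
    using G.perfect by blast
qed

lemma direct_sum:
  "lie_direct_sum smulA UNIV br (lie_product smulA br UNIV UNIV) (lie_center UNIV br)"
proof -
  have "u - lift (proj u) \<in> lie_center UNIV br" for u
    using proj_add[of "u - lift (proj u)" "lift (proj u)"]
    by (simp add: center_eq proj_lift proj_closed)
  then have "\<exists>x y. u = x + y \<and> x \<in> lift ` G \<and> y \<in> lie_center UNIV br" for u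
    using proj_closed[of u] by (intro exI[of _ "lift (proj u)"] exI[of _ "u - lift (proj u)"]) auto
  moreover have "lift ` G \<inter> lie_center UNIV br = {0}"
    using lift_zero proj_zero G.subspace_0[OF G.subspace_carrier]
    by (force simp: center_eq proj_lift)
  ultimately show ?thesis
    unfolding lie_direct_sum_def using A.lie_ideal_derived A.lie_ideal_center
    by (auto simp: derived_eq)
qed

lemma derived_isomorphic:
  "lie_isomorphic smulA (lie_product smulA br UNIV UNIV) br smulG G brG"
proof -
  have "bij_betw proj (lie_product smulA br UNIV UNIV) G"
    by (rule bij_betw_byWitness[of _ lift]) (auto simp: derived_eq proj_lift proj_closed)
  moreover have "lie_algebra smulA (lie_product smulA br UNIV UNIV) br"
    using A.lie_ideal_derived by (intro A.lie_subalgebra) (auto simp: lie_ideal_def)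
  ultimately show ?thesis
    unfolding lie_isomorphic_def
    using G.lie_algebra_axioms proj_add proj_scale proj_br by blast
qed

lemma derived_perfect: "lie_product smulA br (lift ` G) (lift ` G) = lift ` G"
proof -
  have "br u v = br (lift (proj u)) (lift (proj v))" for u v
    by (simp add: br_eq proj_lift proj_closed)
  then have "{br u v |u v. u \<in> UNIV \<and> v \<in> UNIV} = {br u v |u v. u \<in> lift ` G \<and> v \<in> lift ` G}"
    using proj_closed by blast
  then show ?thesis
    unfolding derived_eq[symmetric] by (simp add: lie_product_def)
qed

text \<open>
The elements of \<open>G\<close> whose lift is in \<open>I\<close> form an ideal of \<open>G\<close>. It is not zero: a noncentral \<open>u\<close> in
\<open>I\<close> has a nonzero bracket \<open>[v, u]\<close>, which is in \<open>I\<close> and is the lift of \<open>[proj v, proj u]\<close>. As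
\<open>G\<close> is simple, this ideal is all of \<open>G\<close>.
\<close>

lemma noncentral_ideal:
  assumes I: "lie_ideal smulA UNIV br I" and u: "u \<in> I" "u \<notin> lie_center UNIV br"
  shows "lift ` G \<subseteq> I"
proof -
  let ?J = "{m \<in> G. lift m \<in> I}"
  have sub: "A.subspace I" and br: "\<And>v w. w \<in> I \<Longrightarrow> br v w \<in> I"
    using I by (auto simp: lie_ideal_def)
  have "G.subspace ?J"
    using G.subspace_carrier A.subspace_0[OF sub] A.subspace_add[OF sub] A.subspace_scale[OF sub]
    by (auto simp: G.subspace_def lift_add lift_scale lift_zero)
  moreover have "brG m n \<in> ?J" if "m \<in> G" "n \<in> ?J" for m n
    using that br[of "lift n" "lift m"] by (simp add: br_eq proj_lift G.br_closed)
  ultimately have "lie_ideal smulG G brG ?J"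
    by (auto simp: lie_ideal_def)
  then have J: "?J = {0} \<or> ?J = G" by (rule G.simple)
  obtain v where v: "br v u \<noteq> 0"
    using u(2) A.br_antisym[of u] by (auto simp: lie_center_def)
  have "brG (proj v) (proj u) \<in> ?J"
    using br[OF u(1), of v] by (simp add: br_eq G.br_closed proj_closed)
  moreover have "brG (proj v) (proj u) \<noteq> 0"
    using v lift_zero by (auto simp: br_eq)
  ultimately show ?thesis using J by auto
qed

text \<open>
A solvable ideal is central, since a noncentral one contains the perfect algebra \<open>lift ` G\<close>.
\<close>

lemma reductive: "lie_reductive smulA UNIV br"
proof (rule A.lie_reductiveI)
  fix I assume I: "lie_ideal smulA UNIV br I" "lie_solvable smulA br I"
  obtain m where "m \<in> G" "m \<noteq> 0"
    using G.nonabelian G.br_zero by metis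
  then have "lift m \<noteq> 0" using proj_lift[of m] proj_zero by metis
  then have "lift ` G \<noteq> {0}" using \<open>m \<in> G\<close> by blast
  moreover have "0 \<in> lift ` G"
    using lift_zero G.subspace_0[OF G.subspace_carrier] by force
  ultimately show "I \<subseteq> lie_center UNIV br"
    using A.perfect_not_solvable[OF derived_perfect] noncentral_ideal[OF I(1)] I(2) by blast
qed

end

section \<open>The simple Lie algebra sl(2)\<close>

lemma lie_algebra_mat: "lie_algebra mat_scale UNIV (mat_commutator :: 'k::field^'n^'n \<Rightarrow> _)"
proof -
  have dist: "M ** (N - P) = M ** N - M ** P" "(N - P) ** M = N ** M - P ** M"
    "M ** (N + P) = M ** N + M ** P" "(N + P) ** M = N ** M + P ** M"
    for M N P :: "'k^'n^'n"
    by (simp_all add: matrix_matrix_mult_def vec_eq_iff sum_subtractf sum.distrib algebra_simps)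
  have scale: "mat_scale c M ** N = mat_scale c (M ** N)" "M ** mat_scale c N = mat_scale c (M ** N)"
    for c and M N :: "'k^'n^'n"
    by (simp_all add: matrix_matrix_mult_def mat_scale_def vec_eq_iff sum_distrib_left mult_ac)
  interpret vector_space "mat_scale :: 'k \<Rightarrow> 'k^'n^'n \<Rightarrow> _"
    by unfold_locales (simp_all add: mat_scale_def vec_eq_iff algebra_simps)
  show ?thesis
  proof unfold_locales
    show "subspace UNIV" by (rule subspace_UNIV)
    show "mat_commutator M M = 0" for M :: "'k^'n^'n"
      by (simp add: mat_commutator_def)
    show "mat_commutator M (mat_commutator N P) + mat_commutator N (mat_commutator P M)
        + mat_commutator P (mat_commutator M N) = 0" for M N P :: "'k^'n^'n"
      by (simp add: mat_commutator_def dist matrix_mul_assoc)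
  qed (simp_all add: mat_commutator_def dist scale scale_right_diff_distrib)
qed

lemma trace_scale: "trace (mat_scale c M) = c * trace M"
  by (simp add: trace_def mat_scale_def sum_distrib_left)

lemma trace_commutator: "trace (mat_commutator M N) = 0"
  by (simp add: mat_commutator_def trace_sub trace_mul_sym[of M N])

definition sl2_mat :: "complex \<Rightarrow> complex \<Rightarrow> complex \<Rightarrow> complex^2^2" where
  "sl2_mat a b c = vector [vector [a, b], vector [c, - a]]"

lemma sl2_mat_nth [simp]:
  "sl2_mat a b c $ 1 $ 1 = a" "sl2_mat a b c $ 1 $ 2 = b"
  "sl2_mat a b c $ 2 $ 1 = c" "sl2_mat a b c $ 2 $ 2 = - a"
  by (simp_all add: sl2_mat_def)

lemma sl2_mat_arith:
  "sl2_mat a b c + sl2_mat a' b' c' = sl2_mat (a + a') (b + b') (c + c')"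
  "mat_scale s (sl2_mat a b c) = sl2_mat (s * a) (s * b) (s * c)"
  "mat_commutator (sl2_mat a b c) (sl2_mat a' b' c') =
     sl2_mat (b * c' - b' * c) (2 * (a * b' - a' * b)) (2 * (c * a' - c' * a))"
  "sl2_mat a b c = 0 \<longleftrightarrow> a = 0 \<and> b = 0 \<and> c = 0"
  by (auto simp: vec_eq_iff forall_2 mat_scale_def mat_commutator_def matrix_matrix_mult_def sum_2
      algebra_simps)

lemma sl2_mat_in_carrier: "sl2_mat a b c \<in> sl2_carrier"
  by (simp add: sl2_carrier_def trace_def sum_2)

lemma sl2_carrier_cases:
  assumes "M \<in> sl2_carrier"
  obtains a b c where "M = sl2_mat a b c"
proof
  show "M = sl2_mat (M $ 1 $ 1) (M $ 1 $ 2) (M $ 2 $ 1)"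
    using assms by (simp add: sl2_carrier_def trace_def sum_2 vec_eq_iff forall_2
        eq_neg_iff_add_eq_0 add.commute)
qed

text \<open>
Bracketing twice with \<open>e\<close> sends \<open>a h + b e + c f\<close> to \<open>- 2 c e\<close>, and bracketing once sends
\<open>a h + b e\<close> to \<open>- 2 a e\<close>. Hence a nonzero ideal contains \<open>e\<close>, and bracketing \<open>e\<close> with
\<open>f\<close> produces first a multiple of \<open>h\<close> and then one of \<open>f\<close>.
\<close>

lemma simple_lie_algebra_sl2: "simple_lie_algebra mat_scale sl2_carrier mat_commutator"
proof -
  interpret gl2: lie_algebra mat_scale UNIV "mat_commutator :: complex^2^2 \<Rightarrow> _"
    by (rule lie_algebra_mat)
  have "gl2.subspace sl2_carrier"
    unfolding gl2.subspace_def sl2_carrier_def mem_Collect_eq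
    by (simp add: trace_scale trace_add trace_def[of 0])
  then interpret lie_algebra mat_scale sl2_carrier mat_commutator
    by (rule gl2.lie_subalgebra) (simp_all add: sl2_carrier_def trace_commutator)
  show "simple_lie_algebra mat_scale sl2_carrier mat_commutator"
  proof unfold_locales
    show "\<exists>M\<in>sl2_carrier. \<exists>N\<in>sl2_carrier. mat_commutator M N \<noteq> 0"
    proof (intro bexI)
      show "mat_commutator (sl2_mat 0 1 0) (sl2_mat 0 0 1) \<noteq> 0" by (simp add: sl2_mat_arith)
    qed (rule sl2_mat_in_carrier)+
    fix J assume "lie_ideal mat_scale sl2_carrier mat_commutator J"
    then have sub: "gl2.subspace J" and J: "J \<subseteq> sl2_carrier"
      and br: "\<And>M N. M \<in> sl2_carrier \<Longrightarrow> N \<in> J \<Longrightarrow> mat_commutator M N \<in> J"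
      by (auto simp: lie_ideal_def)
    have scale: "sl2_mat (s * a) (s * b) (s * c) \<in> J" if "sl2_mat a b c \<in> J" for s a b c
      using gl2.subspace_scale[OF sub that] by (simp add: sl2_mat_arith)
    have add: "sl2_mat (a + a') (b + b') (c + c') \<in> J"
      if "sl2_mat a b c \<in> J" "sl2_mat a' b' c' \<in> J" for a b c a' b' c'
      using gl2.subspace_add[OF sub that] by (simp add: sl2_mat_arith)
    \<comment> \<open>The brackets with \<open>e\<close> and \<open>f\<close>, the matrix units above and below the diagonal.\<close>
    have ad_e: "sl2_mat c (- 2 * a) 0 \<in> J" if "sl2_mat a b c \<in> J" for a b c
      using br[OF sl2_mat_in_carrier[of 0 1 0] that] by (simp add: sl2_mat_arith)
    have ad_f: "sl2_mat (- b) 0 (2 * a) \<in> J" if "sl2_mat a b c \<in> J" for a b c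
      using br[OF sl2_mat_in_carrier[of 0 0 1] that] by (simp add: sl2_mat_arith)
    show "J = {0} \<or> J = sl2_carrier"
    proof (cases "J \<subseteq> {0}")
      case True
      then show ?thesis using gl2.subspace_0[OF sub] by blast
    next
      case False
      then obtain a b c where abc: "sl2_mat a b c \<in> J" "a \<noteq> 0 \<or> b \<noteq> 0 \<or> c \<noteq> 0"
      proof -
        obtain M where M: "M \<in> J" "M \<noteq> 0" using False by blast
        then obtain a b c where "M = sl2_mat a b c" using J sl2_carrier_cases by blast
        then show ?thesis using that M by (auto simp: sl2_mat_arith)
      qed
      obtain t where t: "sl2_mat 0 t 0 \<in> J" "t \<noteq> 0"
      proof (cases "c = 0")
        case False
        then show ?thesis using that[of "- 2 * c"] ad_e[OF ad_e[OF abc(1)]] by simp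
      next
        case c: True
        show ?thesis
        proof (cases "a = 0")
          case True
          then show ?thesis using that[of b] abc c by simp
        next
          case False
          then show ?thesis using that[of "- 2 * a"] ad_e[OF abc(1)] c by simp
        qed
      qed
      have e: "sl2_mat 0 1 0 \<in> J" using scale[OF t(1), of "1 / t"] t(2) by simp
      have h: "sl2_mat 1 0 0 \<in> J" using scale[OF ad_f[OF e], of "- 1"] by simp
      have f: "sl2_mat 0 0 1 \<in> J" using scale[OF ad_f[OF h], of "1 / 2"] by simp
      have "sl2_mat x y z \<in> J" for x y z
        using add[OF add[OF scale[OF h, of x] scale[OF e, of y]] scale[OF f, of z]] by simp
      then have "sl2_carrier \<subseteq> J" by (auto elim: sl2_carrier_cases)
      then show ?thesis using J by blast
    qed
  qed
qed

section \<open>The five-dimensional algebra\<close>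

lemma (in vector_space) span_pair: "span {a, b} = {scale s a + scale t b | s t. True}"
  by (auto simp: span_insert span_singleton diff_eq_eq image_iff add.commute)

lemma exhaust_5:
  fixes i :: 5
  shows "i = 1 \<or> i = 2 \<or> i = 3 \<or> i = 4 \<or> i = 5"
proof (induct i)
  case (of_int z)
  then have "z = 0 \<or> z = 1 \<or> z = 2 \<or> z = 3 \<or> z = 4" by fastforce
  then show ?case by auto
qed

lemma forall_5: "(\<forall>i::5. P i) \<longleftrightarrow> P 1 \<and> P 2 \<and> P 3 \<and> P 4 \<and> P 5"
  by (metis exhaust_5)

lemma sum_5: "sum f (UNIV :: 5 set) = f 1 + f 2 + f 3 + f 4 + f 5"
proof -
  have UNIV_5: "UNIV = {1, 2, 3, 4, 5 :: 5}" using exhaust_5 by auto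
  show ?thesis unfolding UNIV_5 by (simp add: ac_simps)
qed

text \<open>
In the basis formed by
\<open>h = x\<^sub>4 - x\<^sub>1 + x\<^sub>2\<close>, \<open>e = x\<^sub>4\<close>, \<open>f = x\<^sub>1 - x\<^sub>3 - x\<^sub>4 + (1 + \<nu>) x\<^sub>5\<close>, \<open>x\<^sub>1 + x\<^sub>2 - x\<^sub>4\<close> and \<open>x\<^sub>5\<close>,
the arguments of \<open>sl2_mat\<close> below are the coordinates of \<open>u\<close> at \<open>h\<close>, \<open>e\<close> and \<open>f\<close>. The section
\<open>A_lift\<close> puts the entries of a traceless matrix back at these three vectors.
\<close>

definition A_proj :: "complex^5 \<Rightarrow> complex^2^2" where
  "A_proj u = sl2_mat ((u $ 2 - u $ 1 - u $ 3) / 2) (u $ 4 + u $ 1) (- u $ 3)"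

definition A_lift :: "real \<Rightarrow> complex^2^2 \<Rightarrow> complex^5" where
  "A_lift \<nu> M = (M $ 1 $ 1) *s (X 4 - X 1 + X 2) + (M $ 1 $ 2) *s X 4
     + (M $ 2 $ 1) *s (X 1 - X 3 - X 4 + complex_of_real (1 + \<nu>) *s X 5)"

lemma sum_bracket_table_row:
  fixes c :: "5 \<Rightarrow> complex"
  shows "(\<Sum>j\<in>UNIV. c j *s bracket_table \<nu> 1 j) =
      c 2 *s (- X 4) + c 3 *s (- X 2 + X 3 + X 4 - complex_of_real (1 + \<nu>) *s X 5) + c 4 *s (- X 4)"
    and "(\<Sum>j\<in>UNIV. c j *s bracket_table \<nu> 2 j) =
      c 3 *s (X 1 - X 3 - X 4 + complex_of_real (1 + \<nu>) *s X 5) + c 4 *s X 4"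
    and "(\<Sum>j\<in>UNIV. c j *s bracket_table \<nu> 3 j) = c 4 *s (- X 1 + X 2)"
    and "(\<Sum>j\<in>UNIV. c j *s bracket_table \<nu> 4 j) = 0"
    and "(\<Sum>j\<in>UNIV. c j *s bracket_table \<nu> 5 j) = 0"
  by (simp_all add: sum_5 bracket_table_def)

text \<open>
Collecting the two occurrences of each table entry makes the sum run over the six listed entries
only, each with the coefficient \<open>u\<^sub>i v\<^sub>j - u\<^sub>j v\<^sub>i\<close>.
\<close>

lemma A_br_sum:
  "A_br \<nu> u v = (\<Sum>i\<in>UNIV. \<Sum>j\<in>UNIV. (u $ i * v $ j - u $ j * v $ i) *s bracket_table \<nu> i j)"
proof -
  have "(\<Sum>i\<in>UNIV. \<Sum>j\<in>UNIV. (u $ i * v $ j) *s bracket_table \<nu> j i)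
      = (\<Sum>i\<in>UNIV. \<Sum>j\<in>UNIV. (u $ j * v $ i) *s bracket_table \<nu> i j)"
    by (rule sum.swap)
  then show ?thesis
    by (simp add: A_br_def vec.scale_left_diff_distrib vec.scale_right_diff_distrib sum_subtractf)
qed

lemma X_nth: "X i $ j = (if i = j then 1 else 0)"
  by (simp add: X_def axis_def)

text \<open>
This is where the table enters. Since \<open>[e, f] = h\<close>, \<open>[h, e] = 2 e\<close>, \<open>[h, f] = - 2 f\<close> and the two
remaining basis vectors are central, comparing the five coordinates leaves polynomial identities in
the coordinates of \<open>u\<close> and \<open>v\<close>.
\<close>

lemma A_br_eq: "A_br \<nu> u v = A_lift \<nu> (mat_commutator (A_proj u) (A_proj v))"
  unfolding A_br_sum sum_bracket_table_row sum_5[of "\<lambda>i. \<Sum>j\<in>UNIV. _ i j"] vec_eq_iff forall_5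
    A_lift_def A_proj_def sl2_mat_arith
  by (simp add: X_nth) (simp add: algebra_simps)

lemma A_proj_linear:
  "A_proj (u + v) = A_proj u + A_proj v" "A_proj (c *s u) = mat_scale c (A_proj u)"
  unfolding A_proj_def sl2_mat_arith
  by (simp_all add: algebra_simps add_divide_distrib diff_divide_distrib)

lemma A_lift_linear:
  "A_lift \<nu> (M + N) = A_lift \<nu> M + A_lift \<nu> N" "A_lift \<nu> (mat_scale c M) = c *s A_lift \<nu> M"
  unfolding A_lift_def mat_scale_def vec_eq_iff by (simp_all add: distrib_left distrib_right mult.assoc)

lemma A_proj_lift: "A_proj (A_lift \<nu> (sl2_mat a b c)) = sl2_mat a b c"
  unfolding A_proj_def A_lift_def by (simp add: X_nth)

lemma split_extension_A:
  "split_extension (*s) mat_scale sl2_carrier mat_commutator A_proj (A_lift \<nu>) (A_br \<nu>)"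
proof (rule split_extension.intro)
  show "vector_space ((*s) :: complex \<Rightarrow> complex^5 \<Rightarrow> _)" by (rule vec.vector_space_axioms)
  show "simple_lie_algebra mat_scale sl2_carrier mat_commutator"
    by (rule simple_lie_algebra_sl2)
  show "split_extension_axioms (*s) mat_scale sl2_carrier mat_commutator A_proj (A_lift \<nu>) (A_br \<nu>)"
  proof (rule split_extension_axioms.intro)
    show "A_proj u \<in> sl2_carrier" for u
      unfolding A_proj_def by (rule sl2_mat_in_carrier)
    show "A_proj (A_lift \<nu> M) = M" if M: "M \<in> sl2_carrier" for M
    proof -
      obtain a b c where "M = sl2_mat a b c" using M by (rule sl2_carrier_cases)
      then show ?thesis by (simp only: A_proj_lift)
    qed
    show "A_br \<nu> u v = A_lift \<nu> (mat_commutator (A_proj u) (A_proj v))" for u v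
      by (rule A_br_eq)
    show "A_proj (u + v) = A_proj u + A_proj v" for u v by (rule A_proj_linear)
    show "A_proj (c *s u) = mat_scale c (A_proj u)" for c u by (rule A_proj_linear)
    show "A_lift \<nu> (M + N) = A_lift \<nu> M + A_lift \<nu> N" for M N by (rule A_lift_linear)
    show "A_lift \<nu> (mat_scale c M) = c *s A_lift \<nu> M" for c M by (rule A_lift_linear)
  qed
qed

lemma lie_algebra_A: "lie_algebra (*s) UNIV (A_br \<nu>)"
  using split_extension.lie_algebra_total[OF split_extension_A] .

lemma A_center_span: "A_center \<nu> = vec.span {X 1 + X 2 - X 4, X 5}"
proof -
  have "A_proj u = 0 \<longleftrightarrow> (\<exists>s t. u = s *s (X 1 + X 2 - X 4) + t *s X 5)" for u
  proof
    assume "A_proj u = 0"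
    then have "u $ 3 = 0" "u $ 2 = u $ 1" "u $ 4 = - (u $ 1)"
      by (auto simp: A_proj_def sl2_mat_arith eq_neg_iff_add_eq_0)
    then have "u = (u $ 1) *s (X 1 + X 2 - X 4) + (u $ 5) *s X 5"
      unfolding vec_eq_iff forall_5 by (simp add: X_nth)
    then show "\<exists>s t. u = s *s (X 1 + X 2 - X 4) + t *s X 5" by blast
  next
    assume "\<exists>s t. u = s *s (X 1 + X 2 - X 4) + t *s X 5"
    then show "A_proj u = 0" by (auto simp: A_proj_def sl2_mat_arith X_nth)
  qed
  then show ?thesis
    unfolding A_center_def split_extension.center_eq[OF split_extension_A] vec.span_pair by blast
qed

lemma dim_A_center: "vec.dim (A_center \<nu>) = 2"
proof -
  have "X 5 \<noteq> X 1 + X 2 - X 4" "vec.independent {X 1 + X 2 - X 4, X 5}"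
    by (auto simp: vec.independent_insert vec.span_singleton X_nth vec_eq_iff forall_5)
  then show ?thesis
    unfolding A_center_span vec.dim_span
    by (subst vec.dim_eq_card_independent) auto
qed

lemma A_span:
  "vec.span ({X 4, X 1 - X 3 - X 4 + complex_of_real (1 + \<nu>) *s X 5, X 4 - X 1 + X 2}
    \<union> lie_center UNIV (A_br \<nu>)) = UNIV"
  (is "vec.span (?S \<union> ?Z) = _")
proof -
  have "A_lift \<nu> M \<in> vec.span (?S \<union> ?Z)" for M
    unfolding A_lift_def by (intro vec.span_add vec.span_scale vec.span_base) auto
  moreover have "z \<in> vec.span (?S \<union> ?Z)" if "z \<in> ?Z" for z
    using that by (simp add: vec.span_base)
  moreover have "\<exists>M z. u = A_lift \<nu> M + z \<and> z \<in> ?Z" for u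
    using split_extension.direct_sum[OF split_extension_A, of \<nu>]
    unfolding lie_direct_sum_def split_extension.derived_eq[OF split_extension_A] by blast
  ultimately have "u \<in> vec.span (?S \<union> ?Z)" for u
    using vec.span_add by metis
  then show ?thesis by blast
qed

theorem proposition5p6:
  fixes \<nu> :: real
  assumes "\<nu> > 0"
  shows "lie_algebra (*s) UNIV (A_br \<nu>)
    \<and> vec.dim (UNIV :: (complex^5) set) = 5
    \<and> lie_reductive (*s) UNIV (A_br \<nu>)
    \<and> A_center \<nu> = vec.span {X 1 + X 2 - X 4, X 5}
    \<and> vec.dim (A_center \<nu>) = 2
    \<and> lie_direct_sum (*s) UNIV (A_br \<nu>) (A_derived \<nu>) (A_center \<nu>)
    \<and> lie_isomorphic (*s) (A_derived \<nu>) (A_br \<nu>) mat_scale sl2_carrier mat_commutator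
    \<and> uea_class (*s) UNIV (A_br \<nu>) (C1 \<nu>) \<in> casimir_elements (*s) UNIV (A_br \<nu>)
    \<and> uea_class (*s) UNIV (A_br \<nu>) C2 \<in> casimir_elements (*s) UNIV (A_br \<nu>)
    \<and> uea_class (*s) UNIV (A_br \<nu>) C3 \<in> casimir_elements (*s) UNIV (A_br \<nu>)"
proof (intro conjI)
  let ?e = "X 4" and ?f = "X 1 - X 3 - X 4 + complex_of_real (1 + \<nu>) *s X 5"
    and ?h = "X 4 - X 1 + X 2"
  show "lie_algebra (*s) UNIV (A_br \<nu>)" by (rule lie_algebra_A)
  show "vec.dim (UNIV :: (complex^5) set) = 5" unfolding vec_dim_card by simp
  show "lie_reductive (*s) UNIV (A_br \<nu>)" by (rule split_extension.reductive[OF split_extension_A])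
  show "A_center \<nu> = vec.span {X 1 + X 2 - X 4, X 5}" by (rule A_center_span)
  show "vec.dim (A_center \<nu>) = 2" by (rule dim_A_center)
  show "lie_direct_sum (*s) UNIV (A_br \<nu>) (A_derived \<nu>) (A_center \<nu>)"
    unfolding A_derived_def A_center_def by (rule split_extension.direct_sum[OF split_extension_A])
  show "lie_isomorphic (*s) (A_derived \<nu>) (A_br \<nu>) mat_scale sl2_carrier mat_commutator"
    unfolding A_derived_def by (rule split_extension.derived_isomorphic[OF split_extension_A])
  have proj: "A_proj ?e = sl2_mat 0 1 0" "A_proj ?f = sl2_mat 0 0 1" "A_proj ?h = sl2_mat 1 0 0"
    by (simp_all add: A_proj_def X_nth)
  have lift: "A_lift \<nu> (sl2_mat a b c) = a *s ?h + b *s ?e + c *s ?f" for a b c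
    by (simp add: A_lift_def)
  show "uea_class (*s) UNIV (A_br \<nu>) (C1 \<nu>) \<in> casimir_elements (*s) UNIV (A_br \<nu>)"
    unfolding C1_def
    by (rule lie_algebra.sl2_casimir[OF lie_algebra_A _ _ _ _ _ _ _ A_span])
      (simp_all only: A_br_eq proj sl2_mat_arith lift, simp_all)
  have "X 1 + X 2 - X 4 \<in> lie_center UNIV (A_br \<nu>)" "X 5 \<in> lie_center UNIV (A_br \<nu>)"
    using A_center_span[of \<nu>] by (auto simp: A_center_def vec.span_base)
  then show "uea_class (*s) UNIV (A_br \<nu>) C2 \<in> casimir_elements (*s) UNIV (A_br \<nu>)"
    "uea_class (*s) UNIV (A_br \<nu>) C3 \<in> casimir_elements (*s) UNIV (A_br \<nu>)"
    unfolding C2_def C3_def by (auto intro: lie_algebra.gen_central[OF lie_algebra_A])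
qed

end
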